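(* Assume that $(Z,d_Z)$ is an absolute $1$-Lipschitz retract and that $G=(V,E)$ is a finite connected (unweighted) graph. Fix $\Omega\subseteq V$ and $f:\Omega\to Z$. Then there exists a mapping $\widetilde f:V\to Z$ which is $\infty$-harmonic on $V\setminus\Omega$ such that $$\widetilde f|_\Omega=f\qquad\text{and}\qquad \mathrm{Lip}_V(\widetilde f)=\mathrm{Lip}_\Omega(f).$$
   Context: A metric space $(Z,d_Z)$ is an absolute $1$-Lipschitz retract if for every metric space $(X,d_X)$, every subset $Y\subseteq X$ and every Lipschitz mapping $f:Y\to Z$ there is $\widetilde f:X\to Z$ with $\widetilde f|_Y=f$ and with the same Lipschitz constant as $f$; equivalently, there is a $1$-Lipschitz retraction onto $Z$ from any metric space containing $Z$. On the vertex set $V$ of the finite connected graph $G$ we use the shortest-path metric $d_G$ (each edge has length $1$). For $v\in V$, $N_G(v)=\{u\in V:uv\in E\}$. For $S\subseteq V$ and a $Z$-valued function $h$ defined on $S$, $\mathrm{Lip}_S(h)=\sup_{x,y\in S,\ x\ne y}\frac{d_Z(h(x),h(y))}{d_G(x,y)}$. A function $h:V\to Z$ is $\infty$-harmonic at $v\in V$ if there exist $u,w\in N_G(v)$ such that $$d_Z(h(u),h(v))=d_Z(h(w),h(v))=\max_{z\in N_G(v)}d_Z(h(z),h(v))\quad\text{and}\quad d_Z(h(u),h(w))=2\max_{z\in N_G(v)}d_Z(h(z),h(v)).$$ It is $\infty$-harmonic on $W\subseteq V$ if it is $\infty$-harmonic at every $v\in W$.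
   Formalization: The formal theorem assumes that Ω is nonempty or G has at least two vertices; for a single vertex with Ω empty there are no neighbours, so the maximum is undefined and no map is ∞-harmonic there. *)

theory Defs
  imports "HOL-Analysis.Analysis" "Graph_Theory.Graph_Theory"
begin

(* The value infinity marks maps that are not Lipschitz; as a supremum in ennreal, the
   constant is 0 when S has at most one point. *)
definition lip_const ::
  "('x \<Rightarrow> 'x \<Rightarrow> real) \<Rightarrow> ('z \<Rightarrow> 'z \<Rightarrow> real) \<Rightarrow> 'x set \<Rightarrow> ('x \<Rightarrow> 'z) \<Rightarrow> ennreal"
  where "lip_const dX dZ S h =
    (SUP (x, y) \<in> {(x, y). x \<in> S \<and> y \<in> S \<and> x \<noteq> y}. ennreal (dZ (h x) (h y) / dX x y))"

(* A definition cannot quantify over types, so the source spaces X have carriers in the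
   type 'z option. This loses nothing: absolute_1_Lipschitz_retract_extension below gives
   the extension property for source spaces over an arbitrary type. *)
definition absolute_1_Lipschitz_retract :: "'z set \<Rightarrow> ('z \<Rightarrow> 'z \<Rightarrow> real) \<Rightarrow> bool"
  where "absolute_1_Lipschitz_retract Z dZ \<longleftrightarrow> Metric_space Z dZ \<and>
    (\<forall>(X :: 'z option set) dX Y f.
       Metric_space X dX \<and> Y \<subseteq> X \<and> f \<in> Y \<rightarrow> Z \<and> lip_const dX dZ Y f < \<infinity> \<longrightarrow>
       (\<exists>g \<in> X \<rightarrow> Z. (\<forall>y\<in>Y. g y = f y) \<and> lip_const dX dZ X g = lip_const dX dZ Y f))"

lemma lip_const_le_iff:
  assumes "Metric_space X dX" "S \<subseteq> X" "L \<ge> 0"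
  shows "lip_const dX dZ S h \<le> ennreal L \<longleftrightarrow>
    (\<forall>x\<in>S. \<forall>y\<in>S. x \<noteq> y \<longrightarrow> dZ (h x) (h y) \<le> L * dX x y)"
proof -
  interpret Metric_space X dX by fact
  have "dZ (h x) (h y) / dX x y \<le> L \<longleftrightarrow> dZ (h x) (h y) \<le> L * dX x y"
    if "x \<in> S" "y \<in> S" "x \<noteq> y" for x y
  proof -
    have "dX x y > 0" using that assms(2) by (meson mdist_pos_less subsetD)
    then show ?thesis by (simp add: pos_divide_le_eq)
  qed
  then show ?thesis
    using assms(3) by (auto simp: lip_const_def SUP_le_iff ennreal_le_iff)
qed

lemma absolute_1_Lipschitz_retract_one_point:
  fixes Z :: "'z set" and dZ :: "'z \<Rightarrow> 'z \<Rightarrow> real" and r :: "'z \<Rightarrow> real"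
  assumes Z: "absolute_1_Lipschitz_retract Z dZ"
    and r1: "\<And>z z'. z \<in> Z \<Longrightarrow> z' \<in> Z \<Longrightarrow> r z \<le> dZ z z' + r z'"
    and r2: "\<And>z z'. z \<in> Z \<Longrightarrow> z' \<in> Z \<Longrightarrow> dZ z z' \<le> r z + r z'"
  shows "\<exists>c\<in>Z. \<forall>z\<in>Z. dZ z c \<le> r z"
proof -
  interpret M: Metric_space Z dZ
    using Z by (simp add: absolute_1_Lipschitz_retract_def)
  have rpos: "r z \<ge> 0" if "z \<in> Z" for z using r2[OF that that] that by simp
  show ?thesis
  proof (cases "\<exists>c\<in>Z. r c = 0")
    case True
    then obtain c where c: "c \<in> Z" "r c = 0" by blast
    have "dZ z c \<le> r z" if "z \<in> Z" for z using r2[OF that c(1)] c by simp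
    with c show ?thesis by blast
  next
    case False
    then have rpos': "r z > 0" if "z \<in> Z" for z
      using rpos[OF that] that by (metis less_eq_real_def)
    define X where "X = insert None (Some ` Z)"
    define dX where "dX p q = (case p of None \<Rightarrow> (case q of None \<Rightarrow> 0 | Some b \<Rightarrow> \<bar>r b\<bar>)
      | Some a \<Rightarrow> (case q of None \<Rightarrow> \<bar>r a\<bar> | Some b \<Rightarrow> dZ a b))" for p q
    have X: "Metric_space X dX"
    proof
      fix p q show "0 \<le> dX p q" by (auto simp: dX_def split: option.splits)
      show "dX p q = dX q p" by (auto simp: dX_def M.commute split: option.splits)
      assume "p \<in> X" "q \<in> X"
      then show "(dX p q = 0) = (p = q)" using rpos'
        by (force simp: X_def dX_def)
      fix s assume "s \<in> X"
      with \<open>p \<in> X\<close> \<open>q \<in> X\<close> show "dX p s \<le> dX p q + dX q s"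
        using r1 r2 rpos M.triangle M.commute
        by (auto simp: X_def dX_def add.commute) (metis add.commute M.commute)+
    qed
    have le: "lip_const dX dZ (Some ` Z) the \<le> ennreal 1"
      by (subst lip_const_le_iff[OF X]) (auto simp: X_def dX_def)
    then have "lip_const dX dZ (Some ` Z) the < \<infinity>"
      by (metis ennreal_less_top infinity_ennreal_def le_less_trans)
    moreover have "Some ` Z \<subseteq> X" "the \<in> Some ` Z \<rightarrow> Z" by (auto simp: X_def)
    ultimately obtain g where g: "g \<in> X \<rightarrow> Z" "\<forall>y\<in>Some ` Z. g y = the y"
      "lip_const dX dZ X g = lip_const dX dZ (Some ` Z) the"
      using Z X unfolding absolute_1_Lipschitz_retract_def by blast
    have "lip_const dX dZ X g \<le> ennreal 1" using g le by simp
    then have lip: "\<forall>x\<in>X. \<forall>y\<in>X. x \<noteq> y \<longrightarrow> dZ (g x) (g y) \<le> dX x y"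
      by (subst (asm) lip_const_le_iff[OF X]) auto
    have "dZ z (g None) \<le> r z" if "z \<in> Z" for z
    proof -
      have "dZ (g (Some z)) (g None) \<le> dX (Some z) None"
        using lip that by (simp add: X_def)
      then show ?thesis using g(2) that rpos[OF that] by (simp add: dX_def)
    qed
    moreover have "g None \<in> Z" using g(1) by (auto simp: X_def)
    ultimately show ?thesis by blast
  qed
qed

lemma absolute_1_Lipschitz_retract_nonempty:
  assumes "absolute_1_Lipschitz_retract Z dZ"
  shows "Z \<noteq> {}"
  using absolute_1_Lipschitz_retract_one_point[OF assms, of "\<lambda>_. 0"] by auto

theorem absolute_1_Lipschitz_retract_extension:
  fixes X :: "'x set" and Z :: "'z set"
  assumes Z: "absolute_1_Lipschitz_retract Z dZ" and X: "Metric_space X dX"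
    and Y: "Y \<subseteq> X" and f: "f \<in> Y \<rightarrow> Z" and fin: "lip_const dX dZ Y f < \<infinity>"
  shows "\<exists>g \<in> X \<rightarrow> Z. (\<forall>y\<in>Y. g y = f y) \<and> lip_const dX dZ X g = lip_const dX dZ Y f"
proof -
  interpret MX: Metric_space X dX by fact
  interpret MZ: Metric_space Z dZ
    using Z by (simp add: absolute_1_Lipschitz_retract_def)
  define L where "L = enn2real (lip_const dX dZ Y f)"
  have L0: "L \<ge> 0" and L: "lip_const dX dZ Y f = ennreal L"
    using fin by (auto simp: L_def)
  have fL: "dZ (f x) (f y) \<le> L * dX x y" if "x \<in> Y" "y \<in> Y" for x y
  proof (cases "x = y")
    case True
    have "y \<in> X" "f y \<in> Z" using that f Y by auto
    then show ?thesis using True by simp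
  next
    case False
    then show ?thesis using lip_const_le_iff[OF X Y L0, of dZ f] L that by simp
  qed
  define ok where "ok F \<longleftrightarrow> F \<subseteq> X \<times> Z \<and> (\<forall>(x, z)\<in>F. \<forall>(x', z')\<in>F. dZ z z' \<le> L * dX x x')" for F
  define F0 where "F0 = (\<lambda>y. (y, f y)) ` Y"
  define A where "A = {F. F0 \<subseteq> F \<and> ok F}"
  have F0: "F0 \<in> A" using f Y fL by (auto simp: A_def ok_def F0_def)
  have "\<exists>M\<in>A. \<forall>F\<in>A. M \<subseteq> F \<longrightarrow> F = M"
  proof (rule subset_Zorn_nonempty)
    show "A \<noteq> {}" using F0 by blast
    fix C assume C: "C \<noteq> {}" "subset.chain A C"
    then have CA: "C \<subseteq> A" and tot: "\<And>F F'. F \<in> C \<Longrightarrow> F' \<in> C \<Longrightarrow> F \<subseteq> F' \<or> F' \<subseteq> F"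
      by (auto simp: subset_chain_def)
    have "dZ z z' \<le> L * dX x x'" if CF: "F \<in> C" "(x, z) \<in> F" "F' \<in> C" "(x', z') \<in> F'" for F F' x z x' z'
    proof -
      obtain F'' where "F'' \<in> C" "(x, z) \<in> F''" "(x', z') \<in> F''"
        using tot[OF CF(1,3)] CF by blast
      moreover from this have "ok F''" using CA by (auto simp: A_def)
      ultimately show ?thesis unfolding ok_def by blast
    qed
    moreover have "\<Union>C \<subseteq> X \<times> Z" using CA unfolding A_def ok_def by blast
    moreover have "F0 \<subseteq> \<Union>C" using C(1) CA unfolding A_def by blast
    ultimately show "\<Union>C \<in> A" by (simp add: A_def ok_def split_beta)
  qed
  then obtain M where MA: "M \<in> A" and max: "\<And>F. F \<in> A \<Longrightarrow> M \<subseteq> F \<Longrightarrow> F = M" by blast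
  have MXZ: "M \<subseteq> X \<times> Z" and Mlip: "\<And>x z x' z'. (x, z) \<in> M \<Longrightarrow> (x', z') \<in> M \<Longrightarrow> dZ z z' \<le> L * dX x x'"
    and M0: "F0 \<subseteq> M"
    using MA by (auto simp: A_def ok_def)
  have dom: "\<exists>z. (p, z) \<in> M" if p: "p \<in> X" for p
  proof -
    have "\<exists>c\<in>Z. \<forall>(x, z)\<in>M. dZ z c \<le> L * dX p x"
    proof (cases "M = {}")
      case True
      then show ?thesis using absolute_1_Lipschitz_retract_nonempty[OF Z] by auto
    next
      case False
      define r where "r z = (INF (x, w)\<in>M. dZ z w + L * dX p x)" for z
      have bdd: "bdd_below ((\<lambda>(x, w). dZ z w + L * dX p x) ` M)" for z
        by (rule bdd_belowI[of _ 0]) (use L0 in auto)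
      have r_le: "r z \<le> dZ z w + L * dX p x" if "(x, w) \<in> M" for z x w
        unfolding r_def using cINF_lower[OF bdd that, of z] by simp
      have r_ge: "k \<le> r z" if "\<And>x w. (x, w) \<in> M \<Longrightarrow> k \<le> dZ z w + L * dX p x" for k z
        unfolding r_def using False that by (intro cINF_greatest) auto
      have r1: "r z \<le> dZ z z' + r z'" if z: "z \<in> Z" "z' \<in> Z" for z z'
      proof -
        have "r z - dZ z z' \<le> r z'"
        proof (rule r_ge)
          fix x w assume xw: "(x, w) \<in> M"
          then have "w \<in> Z" using MXZ by auto
          then show "r z - dZ z z' \<le> dZ z' w + L * dX p x"
            using r_le[OF xw, of z] MZ.triangle[OF z, of w] by simp
        qed
        then show ?thesis by simp
      qed
      have r2: "dZ z z' \<le> r z + r z'" if z: "z \<in> Z" "z' \<in> Z" for z z'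
      proof -
        have "dZ z z' - r z \<le> r z'"
        proof (rule r_ge)
          fix x' w' assume xw': "(x', w') \<in> M"
          have "dZ z z' - (dZ z' w' + L * dX p x') \<le> r z"
          proof (rule r_ge)
            fix x w assume xw: "(x, w) \<in> M"
            have in_sp: "w \<in> Z" "w' \<in> Z" "x \<in> X" "x' \<in> X" using xw xw' MXZ by auto
            have "L * dX x x' \<le> L * (dX p x + dX p x')"
              using MX.triangle[of x p x'] in_sp p MX.commute[of x p] L0
              by (intro mult_left_mono) auto
            then have "dZ w w' \<le> L * dX p x + L * dX p x'"
              using Mlip[OF xw xw'] by (simp add: distrib_left)
            moreover have "dZ z z' \<le> dZ z w + dZ w w' + dZ z' w'"
              using MZ.triangle[of z w z'] MZ.triangle[of w w' z'] MZ.commute[of w' z'] in_sp z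
              by simp
            ultimately show "dZ z z' - (dZ z' w' + L * dX p x') \<le> dZ z w + L * dX p x" by simp
          qed
          then show "dZ z z' - r z \<le> dZ z' w' + L * dX p x'" by simp
        qed
        then show ?thesis by simp
      qed
      obtain c where c: "c \<in> Z" "\<And>z. z \<in> Z \<Longrightarrow> dZ z c \<le> r z"
        using absolute_1_Lipschitz_retract_one_point[OF Z, of r] r1 r2 by blast
      have "dZ z c \<le> L * dX p x" if "(x, z) \<in> M" for x z
      proof -
        have "z \<in> Z" using that MXZ by auto
        then show ?thesis using c(2)[of z] r_le[OF that, of z] by simp
      qed
      with c(1) show ?thesis by blast
    qed
    then obtain c where c: "c \<in> Z" "\<And>x z. (x, z) \<in> M \<Longrightarrow> dZ z c \<le> L * dX p x" by blast
    have c': "dZ c z \<le> L * dX p x" "dZ z c \<le> L * dX x p" if "(x, z) \<in> M" for x z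
      using c(2)[OF that] MZ.commute[of c z] MX.commute[of p x] by auto
    have pp: "dZ c c \<le> L * dX p p" using p c(1) by simp
    have "dZ z z' \<le> L * dX x x'" if "(x, z) \<in> insert (p, c) M" "(x', z') \<in> insert (p, c) M"
      for x z x' z'
      using that Mlip[of x z x' z'] c' pp by blast
    then have "ok (insert (p, c) M)" unfolding ok_def using MXZ p c(1) by blast
    then have "insert (p, c) M \<in> A" using M0 by (auto simp: A_def)
    then show ?thesis using max[of "insert (p, c) M"] by blast
  qed
  define g where "g x = (SOME z. (x, z) \<in> M)" for x
  have gM: "(x, g x) \<in> M" if "x \<in> X" for x
    unfolding g_def using dom[OF that] by (rule someI_ex)
  have gX: "g \<in> X \<rightarrow> Z" using gM MXZ by blast
  have gY: "g y = f y" if y: "y \<in> Y" for y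
  proof -
    have yX: "y \<in> X" and "(y, f y) \<in> M" using y Y M0 by (auto simp: F0_def)
    then have "dZ (g y) (f y) \<le> 0" using Mlip[OF gM[OF yX], of y "f y"] by simp
    moreover have "g y \<in> Z" "f y \<in> Z" using gX yX f y by auto
    ultimately show ?thesis using MZ.mdist_pos_less by fastforce
  qed
  have "lip_const dX dZ X g \<le> ennreal L"
    unfolding lip_const_le_iff[OF X order_refl L0] using Mlip gM by blast
  moreover have "lip_const dX dZ Y f = lip_const dX dZ Y g"
    unfolding lip_const_def by (rule SUP_cong) (auto simp: gY)
  moreover have "lip_const dX dZ Y g \<le> lip_const dX dZ X g"
    unfolding lip_const_def using Y by (intro SUP_subset_mono) auto
  ultimately have "lip_const dX dZ X g = lip_const dX dZ Y f" using L by simp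
  with gX gY show ?thesis by blast
qed

(* Undirected graphs are symmetric digraphs (locale graph). If u and v are connected, the
   ereal infimum over walks with unit arc weights is finite, so real_of_ereal is faithful. *)
definition graph_dist :: "('v, 'e) pre_digraph \<Rightarrow> 'v \<Rightarrow> 'v \<Rightarrow> real"
  where "graph_dist G u v = real_of_ereal (wf_digraph.\<mu> G (\<lambda>_. 1) u v)"

definition neighbours :: "('v, 'e) pre_digraph \<Rightarrow> 'v \<Rightarrow> 'v set"
  where "neighbours G v = {u. v \<rightarrow>\<^bsub>G\<^esub> u}"

(* Requires a neighbour: the condition is meaningless at an isolated vertex. *)
definition infinity_harmonic_at ::
  "('v, 'e) pre_digraph \<Rightarrow> ('z \<Rightarrow> 'z \<Rightarrow> real) \<Rightarrow> ('v \<Rightarrow> 'z) \<Rightarrow> 'v \<Rightarrow> bool"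
  where "infinity_harmonic_at G dZ h v \<longleftrightarrow>
    (let m = Max ((\<lambda>z. dZ (h z) (h v)) ` neighbours G v) in
     \<exists>u \<in> neighbours G v. \<exists>w \<in> neighbours G v.
       dZ (h u) (h v) = m \<and> dZ (h w) (h v) = m \<and> dZ (h u) (h w) = 2 * m)"

definition infinity_harmonic_on ::
  "('v, 'e) pre_digraph \<Rightarrow> ('z \<Rightarrow> 'z \<Rightarrow> real) \<Rightarrow> ('v \<Rightarrow> 'z) \<Rightarrow> 'v set \<Rightarrow> bool"
  where "infinity_harmonic_on G dZ h W \<longleftrightarrow> (\<forall>v\<in>W. infinity_harmonic_at G dZ h v)"

end

theory Submission
  imports Defs
begin

text \<open>
  The extension is built one vertex at a time. Given \<open>f\<close> on \<open>S\<close>, let \<open>L\<close> be the largest slope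
  \<open>dZ (f x) (f y) / n\<close> over all walks of length \<open>n\<close> between points of \<open>S\<close> which use no edge inside
  \<open>S\<close>. Since \<open>Z\<close> is an absolute 1-Lipschitz retract, \<open>f\<close> extends to a map \<open>g\<close> stretching every such edge
  by at most \<open>L\<close>. If \<open>L = 0\<close>, then \<open>g\<close> is already harmonic off \<open>S\<close>. Otherwise take a
  walk \<open>x\<^sub>0, x\<^sub>1, \<dots>, x\<^sub>n\<close> of slope \<open>L\<close>, fix the value of \<open>g\<close> at \<open>x\<^sub>1 \<notin> S\<close> and recurse on
  \<open>S \<union> {x\<^sub>1}\<close>. All later slopes are at most \<open>L\<close>, so the images of \<open>x\<^sub>0, \<dots>, x\<^sub>n\<close> in the final map are
  equally spaced on a geodesic of length \<open>n L\<close>, and \<open>x\<^sub>0\<close>, \<open>x\<^sub>2\<close> witness harmonicity at \<open>x\<^sub>1\<close>.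
\<close>

section \<open>Metrics from least walk lengths\<close>

lemma sym_relpow: "sym R \<Longrightarrow> (x, y) \<in> R ^^ n \<Longrightarrow> (y, x) \<in> R ^^ n"
proof (induction n arbitrary: y)
  case (Suc n)
  then obtain z where "(x, z) \<in> R ^^ n" "(z, y) \<in> R" by auto
  then show ?case using Suc by (meson relpow_Suc_I2 symD)
qed auto

text \<open>Read \<open>W n x y\<close> as: \<open>y\<close> can be reached from \<open>x\<close> at
  cost \<open>n\<close>. Keeping \<open>W\<close> abstract covers both the plain walk distance and
  its truncation at a fixed cost. The assumption \<open>trans\<close> asks only for some
  \<open>k \<le> m + n\<close>, since truncated costs need not add up exactly; least costs still
  satisfy the triangle inequality.\<close>

lemma Metric_space_Least:
  fixes W :: "nat \<Rightarrow> 'a \<Rightarrow> 'a \<Rightarrow> bool"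
  assumes zero: "\<And>x y. W 0 x y \<longleftrightarrow> x = y"
    and sym: "\<And>n x y. W n x y \<Longrightarrow> W n y x"
    and trans: "\<And>m n x y z. W m x y \<Longrightarrow> W n y z \<Longrightarrow> \<exists>k\<le>m + n. W k x z"
    and ex: "\<And>x y. x \<in> V \<Longrightarrow> y \<in> V \<Longrightarrow> \<exists>n. W n x y"
  shows "Metric_space V (\<lambda>x y. real (LEAST n. W n x y))"
proof
  fix x y
  show "0 \<le> real (LEAST n. W n x y)" by simp
  have "(\<lambda>n. W n x y) = (\<lambda>n. W n y x)" using sym by blast
  then show "real (LEAST n. W n x y) = real (LEAST n. W n y x)" by simp
next
  fix x y assume V: "x \<in> V" "y \<in> V"
  show "real (LEAST n. W n x y) = 0 \<longleftrightarrow> x = y"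
    using LeastI_ex[OF ex[OF V]] zero
    by (metis Least_eq_0 of_nat_eq_0_iff)
  fix z assume z: "z \<in> V"
  obtain k where "k \<le> (LEAST n. W n x y) + (LEAST n. W n y z)" "W k x z"
    using trans LeastI_ex[OF ex] V z by metis
  then have "(LEAST n. W n x z) \<le> (LEAST n. W n x y) + (LEAST n. W n y z)"
    using Least_le[of "\<lambda>n. W n x z" k] by linarith
  then show "real (LEAST n. W n x z) \<le> real (LEAST n. W n x y) + real (LEAST n. W n y z)"
    by linarith
qed

section \<open>Extension with bounded stretch along arcs\<close>

text \<open>The assumption \<open>lip\<close> makes \<open>f\<close> \<open>K\<close>-Lipschitz for
  walk length in \<open>R\<close>, and the two ends of a pair in \<open>R\<close> are at walk
  distance at most 1, so a \<open>K\<close>-Lipschitz extension stretches each such pair by at most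
  \<open>K\<close>. The case \<open>K = 0\<close> is separate because no truncation length
  \<open>N\<close> can then achieve \<open>B \<le> K * N\<close> for positive
  \<open>B\<close>.\<close>

lemma absolute_1_Lipschitz_retract_relation_extension:
  fixes Z :: "'z set" and R :: "'a rel"
  assumes Z: "absolute_1_Lipschitz_retract Z dZ"
    and R: "sym R" "R \<subseteq> V \<times> V"
    and S: "finite S" "S \<subseteq> V" and f: "f \<in> S \<rightarrow> Z" and K: "K \<ge> 0"
    and lip: "\<And>x y n. x \<in> S \<Longrightarrow> y \<in> S \<Longrightarrow> (x, y) \<in> R ^^ n \<Longrightarrow> dZ (f x) (f y) \<le> K * real n"
  shows "\<exists>g \<in> V \<rightarrow> Z. (\<forall>s\<in>S. g s = f s) \<and> (\<forall>(x, y)\<in>R. dZ (g x) (g y) \<le> K)"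
proof -
  interpret MZ: Metric_space Z dZ
    using Z by (simp add: absolute_1_Lipschitz_retract_def)
  obtain z0 where z0: "z0 \<in> Z" using absolute_1_Lipschitz_retract_nonempty[OF Z] by blast
  show ?thesis
  proof (cases "K = 0")
    case True
    have eq: "f x = f y" if "x \<in> S" "y \<in> S" "(x, y) \<in> R\<^sup>*" for x y
    proof -
      from that(3) obtain n where "(x, y) \<in> R ^^ n" using rtrancl_imp_relpow by blast
      then have "dZ (f x) (f y) \<le> 0" using lip that True by fastforce
      then show ?thesis using f that MZ.mdist_pos_less
        by (metis PiE not_le)
    qed
    \<comment> \<open>For \<open>K = 0\<close> the map \<open>f\<close> is constant on the part of
      \<open>S\<close> in each component of \<open>R\<close>. The map \<open>g\<close> spreads this
      value over the component and takes the default \<open>z0\<close> on components that miss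
      \<open>S\<close>.\<close>
    define P where "P v s \<longleftrightarrow> s \<in> S \<and> (v, s) \<in> R\<^sup>*" for v s
    define g where "g v = (if \<exists>s. P v s then f (SOME s. P v s) else z0)" for v
    have P: "P v (SOME s. P v s)" if "P v s" for v s using that by (rule someI)
    have gv: "g v = f s" if "P v s" for v s
    proof -
      have "((SOME s. P v s), s) \<in> R\<^sup>*"
        using P[OF that] that sym_rtrancl[OF R(1)] by (meson P_def rtrancl_trans symD)
      then show ?thesis using eq P[OF that] that by (auto simp: g_def P_def)
    qed
    have g: "g v \<in> Z" for v
    proof (cases "\<exists>s. P v s")
      case True
      then obtain s where "P v s" by blast
      then show ?thesis using gv f by (auto simp: P_def)
    qed (use z0 in \<open>simp add: g_def\<close>)
    have "g x = g y" if "(x, y) \<in> R" for x y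
    proof -
      have "P x = P y" unfolding P_def using that R(1)
        by (meson converse_rtrancl_into_rtrancl symD)
      then show ?thesis by (simp add: g_def)
    qed
    moreover have "g s = f s" if "s \<in> S" for s using gv[of s s] that by (simp add: P_def)
    ultimately show ?thesis using g True
      by (intro bexI[of _ g]) (auto simp: MZ.mdist_zero)
  next
    case False
    with K have K: "K > 0" by simp
    \<comment> \<open>Truncating the walk distance at \<open>N\<close> makes it finite between different components;
      \<open>N\<close> is so large that this does not affect the Lipschitz condition on \<open>S\<close>.\<close>
    obtain B where B: "\<And>x y. x \<in> S \<Longrightarrow> y \<in> S \<Longrightarrow> dZ (f x) (f y) \<le> B"
    proof -
      have "finite ((\<lambda>(x, y). dZ (f x) (f y)) ` (S \<times> S))" using S by simp
      then have "bdd_above ((\<lambda>(x, y). dZ (f x) (f y)) ` (S \<times> S))"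
        by (rule bdd_above_finite)
      then show ?thesis using that by (force simp: bdd_above_def)
    qed
    obtain N0 :: nat where N0: "B / K \<le> real N0" using real_arch_simple by blast
    \<comment> \<open>The successor makes \<open>N\<close> positive, so that the truncated distance
      still separates points.\<close>
    define N where "N = Suc N0"
    have N: "B \<le> K * real N"
    proof -
      have "B \<le> K * real N0" using N0 K by (simp add: field_simps)
      also have "\<dots> \<le> K * real N" using K by (simp add: N_def)
      finally show ?thesis .
    qed
    define W where "W n x y \<longleftrightarrow> n = N \<or> (x, y) \<in> R ^^ n" for n x y
    define d where "d x y = real (LEAST n. W n x y)" for x y
    have ex: "\<exists>n. W n x y" for x y by (auto simp: W_def)
    have d: "Metric_space V d"
      unfolding d_def
    proof (rule Metric_space_Least)
      show "W 0 x y \<longleftrightarrow> x = y" for x y by (auto simp: W_def N_def)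
      show "W n x y \<Longrightarrow> W n y x" for n x y using sym_relpow[OF R(1)] by (auto simp: W_def)
      show "\<exists>k\<le>m + n. W k x z" if W: "W m x y" "W n y z" for m n x y z
      proof (cases "m = N \<or> n = N")
        case True
        then have "N \<le> m + n" by auto
        then show ?thesis unfolding W_def by blast
      next
        case False
        then have "(x, z) \<in> R ^^ (m + n)" using W relpow_trans by (auto simp: W_def)
        then show ?thesis unfolding W_def by blast
      qed
      show "\<exists>n. W n x y" for x y by (rule ex)
    qed
    have "lip_const d dZ S f \<le> ennreal K"
      unfolding lip_const_le_iff[OF d S(2) less_imp_le[OF K]]
    proof (intro ballI impI)
      fix x y assume xy: "x \<in> S" "y \<in> S"
      have "W (LEAST n. W n x y) x y" using ex by (rule LeastI_ex)
      then show "dZ (f x) (f y) \<le> K * d x y"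
        unfolding d_def using lip[OF xy] B[OF xy] N by (auto simp: W_def)
    qed
    moreover from this have "lip_const d dZ S f < \<infinity>"
      by (metis ennreal_less_top infinity_ennreal_def le_less_trans)
    ultimately obtain g where g: "g \<in> V \<rightarrow> Z" "\<forall>y\<in>S. g y = f y" "lip_const d dZ V g \<le> ennreal K"
      using absolute_1_Lipschitz_retract_extension[OF Z d S(2) f] by metis
    have "dZ (g x) (g y) \<le> K" if "(x, y) \<in> R" for x y
    proof (cases "x = y")
      case True
      then show ?thesis using g(1) that R(2) K by (auto simp: MZ.mdist_zero Pi_iff)
    next
      case False
      have "(LEAST n. W n x y) \<le> 1" using that by (intro Least_le) (simp add: W_def)
      then have "K * d x y \<le> K" using K by (simp add: d_def mult_left_le)
      then show ?thesis
        using g(3) that R(2) False unfolding lip_const_le_iff[OF d order_refl less_imp_le[OF K]]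
        by fastforce
    qed
    with g show ?thesis by blast
  qed
qed

section \<open>Harmonic extension off a set of fixed vertices\<close>

lemma Metric_space_relpow_bound:
  assumes "Metric_space Z d" "h \<in> V \<rightarrow> Z" "R \<subseteq> V \<times> V"
    and edge: "\<And>x y. (x, y) \<in> R \<Longrightarrow> d (h x) (h y) \<le> K"
    and "x \<in> V" "(x, y) \<in> R ^^ n"
  shows "d (h x) (h y) \<le> K * real n"
  using assms(5,6)
proof (induction n arbitrary: x)
  case 0
  then have "x = y" "h y \<in> Z" using assms(2) by auto
  then show ?case using Metric_space.mdist_zero[OF assms(1)] by simp
next
  case (Suc n)
  then obtain z where z: "(x, z) \<in> R" "(z, y) \<in> R ^^ n" by (meson relpow_Suc_D2)
  then have zV: "z \<in> V" using assms(3) by auto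
  then have yV: "y \<in> V" using z(2) assms(3) by (cases n) (auto elim: relpow_Suc_E)
  have "d (h x) (h y) \<le> d (h x) (h z) + d (h z) (h y)"
    using Metric_space.triangle[OF assms(1)] Suc.prems zV yV assms(2) by auto
  then show ?case using edge[OF z(1)] Suc.IH[OF zV z(2)] by (simp add: distrib_left)
qed

lemma infinity_harmonic_atI:
  assumes "finite (neighbours G v)" "u \<in> neighbours G v" "w \<in> neighbours G v"
    and "dZ (h u) (h v) = m" "dZ (h w) (h v) = m" "dZ (h u) (h w) = 2 * m"
    and "\<And>z. z \<in> neighbours G v \<Longrightarrow> dZ (h z) (h v) \<le> m"
  shows "infinity_harmonic_at G dZ h v"
proof -
  have "Max ((\<lambda>z. dZ (h z) (h v)) ` neighbours G v) = m"
    using assms by (intro Max_eqI) auto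
  then show ?thesis unfolding infinity_harmonic_at_def Let_def using assms by blast
qed

text \<open>Arcs inside \<open>S\<close> are left out because both their values are already fixed:
  their stretch cannot be influenced any more and may exceed the slopes of later stages.\<close>

definition edges_off :: "('v, 'e) pre_digraph \<Rightarrow> 'v set \<Rightarrow> 'v rel"
  where "edges_off G S = arcs_ends G - S \<times> S"

text \<open>The arc bound in the conclusion is what makes the induction work. Harmonicity at a newly
  fixed vertex depends on values chosen later; the recursive call, made with \<open>K\<close>
  replaced by the slope \<open>L\<close>, returns a bound on these values strong enough to force
  equality in the triangle inequality.\<close>

lemma infinity_harmonic_extension:
  fixes G :: "('v, 'e) pre_digraph" and Z :: "'z set"
  assumes Z: "absolute_1_Lipschitz_retract Z dZ" and G: "graph G"
    and nbr: "\<And>v. v \<in> verts G - S \<Longrightarrow> neighbours G v \<noteq> {}"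
    and "S \<subseteq> verts G" "f \<in> S \<rightarrow> Z" "K \<ge> 0"
    and "\<And>x y n. x \<in> S \<Longrightarrow> y \<in> S \<Longrightarrow> (x, y) \<in> edges_off G S ^^ n \<Longrightarrow>
      dZ (f x) (f y) \<le> K * real n"
  shows "\<exists>h \<in> verts G \<rightarrow> Z. infinity_harmonic_on G dZ h (verts G - S) \<and> (\<forall>s\<in>S. h s = f s) \<and>
    (\<forall>(x, y)\<in>edges_off G S. dZ (h x) (h y) \<le> K)"
  using assms(3-)
proof (induction "card (verts G - S)" arbitrary: S f K rule: less_induct)
  case less
  interpret G: graph G by fact
  interpret MZ: Metric_space Z dZ
    using Z by (simp add: absolute_1_Lipschitz_retract_def)
  let ?V = "verts G" and ?R = "edges_off G S"
  note nbr = less.prems(1) and SV = less.prems(2) and f = less.prems(3)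
    and K = less.prems(4) and lip = less.prems(5)
  have RV: "edges_off G T \<subseteq> ?V \<times> ?V" for T
    using G.adj_in_verts by (auto simp: edges_off_def)
  have symR: "sym (edges_off G T)" for T
    using G.sym_arcs by (auto simp: edges_off_def symmetric_def sym_def)
  have finS: "finite S" using SV G.finite_verts finite_subset by blast
  have finN: "finite (neighbours G v)" for v
    using G.finite_verts by (rule finite_subset[rotated]) (auto simp: neighbours_def G.adj_in_verts)
  have off: "(v, z) \<in> ?R" "(z, v) \<in> ?R" if "v \<in> ?V - S" "z \<in> neighbours G v" for v z
    using that symR[of S] by (auto simp: edges_off_def neighbours_def sym_def)

  define len where "len x y = (LEAST n. (x, y) \<in> ?R ^^ n)" for x y
  have len: "(x, y) \<in> ?R ^^ len x y" "len x y \<le> n" if "(x, y) \<in> ?R ^^ n" for x y n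
    using that unfolding len_def by (auto intro: LeastI Least_le)
  have len_pos: "len x y > 0" if "(x, y) \<in> ?R ^^ n" "x \<noteq> y" for x y n
    using len(1)[OF that(1)] that(2) by (metis gr0I relpow_0_E)
  \<comment> \<open>The set \<open>P\<close> keeps only pairs joined by a walk, as
    \<open>len\<close> is meaningless for the others.\<close>
  define P where "P = {(x, y). x \<in> S \<and> y \<in> S \<and> x \<noteq> y \<and> (\<exists>n. (x, y) \<in> ?R ^^ n)}"
  have "P \<subseteq> S \<times> S" by (auto simp: P_def)
  then have finP: "finite P" using finS finite_subset by blast
  define slope where "slope = (\<lambda>(x, y). dZ (f x) (f y) / real (len x y))"
  \<comment> \<open>Inserting 0 covers an empty \<open>P\<close>, and if \<open>L\<close> is
    nonzero, it is attained at a pair in \<open>P\<close>.\<close>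
  define L where "L = Max (insert 0 (slope ` P))"
  have L0: "L \<ge> 0" unfolding L_def using finP by simp
  have L_ge: "slope p \<le> L" if "p \<in> P" for p unfolding L_def using finP that by simp
  have lipL: "dZ (f x) (f y) \<le> L * real n" if "x \<in> S" "y \<in> S" "(x, y) \<in> ?R ^^ n" for x y n
  proof (cases "x = y")
    case True
    then show ?thesis using f that L0 by (auto simp: MZ.mdist_zero Pi_iff)
  next
    case False
    then have "dZ (f x) (f y) / real (len x y) \<le> L"
      using L_ge[of "(x, y)"] that by (auto simp: P_def slope_def)
    then have "dZ (f x) (f y) \<le> L * real (len x y)"
      using len_pos[OF that(3) False] by (simp add: field_simps)
    also have "\<dots> \<le> L * real n" using L0 len(2)[OF that(3)] by (intro mult_left_mono) auto
    finally show ?thesis .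
  qed
  have slopeK: "slope p \<le> K" if "p \<in> P" for p
  proof -
    obtain x y n where p: "p = (x, y)" "x \<in> S" "y \<in> S" "x \<noteq> y" "(x, y) \<in> ?R ^^ n"
      using \<open>p \<in> P\<close> by (auto simp: P_def)
    then show ?thesis using lip[OF p(2,3) len(1)[OF p(5)]] len_pos[OF p(5,4)]
      by (simp add: slope_def field_simps)
  qed
  have LK: "L \<le> K" unfolding L_def using finP K slopeK by simp
  obtain g where g: "g \<in> ?V \<rightarrow> Z" "\<forall>s\<in>S. g s = f s" "\<And>x y. (x, y) \<in> ?R \<Longrightarrow> dZ (g x) (g y) \<le> L"
    using absolute_1_Lipschitz_retract_relation_extension
        [OF Z symR RV finS SV f L0 lipL]
    by blast
  show ?case
  proof (cases "L = 0")
    case True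
    have "infinity_harmonic_at G dZ g v" if v: "v \<in> ?V - S" for v
    proof -
      have 0: "dZ (g z) (g v) = 0" if "z \<in> neighbours G v" for z
        using g(3)[OF off(2)[OF v that]] True by (simp add: order_antisym)
      \<comment> \<open>All distances at \<open>v\<close> vanish, so a single neighbour serves as
        both witnesses with maximum 0.\<close>
      obtain u where u: "u \<in> neighbours G v" using nbr[OF v] by blast
      then have "g u \<in> Z" using off[OF v u] RV g(1) by blast
      then show ?thesis using 0 u
        by (intro infinity_harmonic_atI[of G v u u dZ g 0] finN u) auto
    qed
    moreover have "dZ (g a) (g b) \<le> K" if "(a, b) \<in> ?R" for a b
      using g(3)[OF that] LK by simp
    ultimately show ?thesis using g(1,2)
      by (intro bexI[of _ g]) (auto simp: infinity_harmonic_on_def)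
  next
    case False
    then have Lpos: "L > 0" using L0 by simp
    have "L \<in> insert 0 (slope ` P)" unfolding L_def using finP by (intro Max_in) auto
    then obtain x y n0 where xy: "x \<in> S" "y \<in> S" "x \<noteq> y" "(x, y) \<in> ?R ^^ n0" "slope (x, y) = L"
      using False by (auto simp: P_def)
    have tight: "dZ (f x) (f y) = L * real (len x y)"
      using xy(5) len_pos[OF xy(4,3)] by (auto simp: slope_def field_simps)
    obtain k where k: "len x y = Suc k" using len_pos[OF xy(4,3)] gr0_implies_Suc by blast
    obtain v where v: "(x, v) \<in> ?R" "(v, y) \<in> ?R ^^ k"
      using len(1)[OF xy(4)] unfolding k by (meson relpow_Suc_D2)
    have vS: "v \<in> ?V - S" using v(1) xy(1) RV by (auto simp: edges_off_def)
    \<comment> \<open>Since \<open>y\<close> lies in \<open>S\<close> and \<open>v\<close> does not,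
      the walk continues beyond \<open>v\<close>. The next vertex \<open>w\<close> is
      \<open>y\<close> itself when \<open>j = 0\<close>.\<close>
    then obtain j where j: "k = Suc j" using v(2) xy(2) by (cases k) auto
    obtain w where w: "(v, w) \<in> ?R" "(w, y) \<in> ?R ^^ j"
      using v(2) unfolding j by (meson relpow_Suc_D2)
    let ?S = "insert v S"
    have sub: "edges_off G ?S \<subseteq> ?R" by (auto simp: edges_off_def)
    \<comment> \<open>The recursion prescribes the values of \<open>g\<close> on \<open>?S\<close>.
      Its walk condition holds with constant \<open>L\<close> because \<open>g\<close> is defined on
      all vertices and stretches each remaining arc by at most \<open>L\<close>.\<close>
    have "\<exists>h \<in> ?V \<rightarrow> Z. infinity_harmonic_on G dZ h (?V - ?S) \<and> (\<forall>s\<in>?S. h s = g s) \<and>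
      (\<forall>(a, b)\<in>edges_off G ?S. dZ (h a) (h b) \<le> L)"
    proof (rule less.hyps[OF _ _ _ _ L0])
      show "card (?V - ?S) < card (?V - S)"
        using vS G.finite_verts by (intro psubset_card_mono) auto
      show "neighbours G u \<noteq> {}" if "u \<in> ?V - ?S" for u using nbr[of u] that by blast
      show "?S \<subseteq> ?V" "g \<in> ?S \<rightarrow> Z" using g(1) SV vS by auto
      show "dZ (g a) (g b) \<le> L * real n"
        if "a \<in> ?S" "b \<in> ?S" "(a, b) \<in> edges_off G ?S ^^ n" for a b n
      proof (rule Metric_space_relpow_bound[OF MZ.Metric_space_axioms g(1) RV _ _ that(3)])
        show "dZ (g p) (g q) \<le> L" if "(p, q) \<in> edges_off G ?S" for p q
          using g(3) sub that by blast
        show "a \<in> ?V" using that(1) SV vS by auto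
      qed
    qed
    then obtain h where h: "h \<in> ?V \<rightarrow> Z" "infinity_harmonic_on G dZ h (?V - ?S)"
      "\<forall>s\<in>?S. h s = g s" "\<forall>(a, b)\<in>edges_off G ?S. dZ (h a) (h b) \<le> L"
      by blast
    \<comment> \<open>An arc of \<open>?R\<close> lost in passing to \<open>?S\<close> has both ends
      in \<open>?S\<close>, where \<open>h\<close> agrees with \<open>g\<close>.\<close>
    have hL: "dZ (h a) (h b) \<le> L" if "(a, b) \<in> ?R" for a b
    proof (cases "(a, b) \<in> edges_off G ?S")
      case True
      then show ?thesis using h(4) by blast
    next
      case False
      then have "a \<in> ?S" "b \<in> ?S" using that by (auto simp: edges_off_def)
      then show ?thesis using h(3) g(3)[OF that] by auto
    qed
    have hS: "\<forall>s\<in>S. h s = f s" using h(3) g(2) by simp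
    have inV: "x \<in> ?V" "v \<in> ?V" "w \<in> ?V" "y \<in> ?V" using v w xy RV SV by auto
    then have inZ: "h x \<in> Z" "h v \<in> Z" "h w \<in> Z" "h y \<in> Z" using h(1) by auto
    have hxy: "dZ (h x) (h y) = L * (real j + 2)"
      using tight hS xy by (simp add: k j algebra_simps)
    have hwy: "dZ (h w) (h y) \<le> L * real j"
      using Metric_space_relpow_bound[OF MZ.Metric_space_axioms h(1) RV hL inV(3) w(2)] .
    have hxv: "dZ (h x) (h v) \<le> L" and hvw: "dZ (h v) (h w) \<le> L" using hL v w by auto
    \<comment> \<open>The total \<open>L * (j + 2)\<close> leaves at least \<open>2 * L\<close> for
      the distance from \<open>h x\<close> to \<open>h w\<close>, while the two arcs through
      \<open>v\<close> allow at most \<open>L\<close> each. Hence all these bounds are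
      equalities.\<close>
    have "dZ (h x) (h y) \<le> dZ (h x) (h w) + dZ (h w) (h y)"
      "dZ (h x) (h w) \<le> dZ (h x) (h v) + dZ (h v) (h w)"
      using MZ.triangle inZ by auto
    then have eqs: "dZ (h x) (h v) = L" "dZ (h w) (h v) = L" "dZ (h x) (h w) = 2 * L"
      using hxy hwy hxv hvw MZ.commute[of "h w" "h v"] by (simp_all add: algebra_simps)
    have xwN: "x \<in> neighbours G v" "w \<in> neighbours G v"
      using v(1) w(1) symR[of S] by (auto simp: neighbours_def edges_off_def sym_def)
    have "infinity_harmonic_at G dZ h v"
      using hL off[OF vS] by (intro infinity_harmonic_atI[of G v x w dZ h L] finN xwN eqs) auto
    then have "infinity_harmonic_on G dZ h (?V - S)"
      using h(2) by (auto simp: infinity_harmonic_on_def)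
    moreover have "dZ (h a) (h b) \<le> K" if "(a, b) \<in> ?R" for a b
      using hL[OF that] LK by simp
    ultimately show ?thesis using h(1) hS by (intro bexI[of _ h]) auto
  qed
qed

section \<open>Graph distance as least walk length\<close>

context wf_digraph
begin

text \<open>The condition \<open>u \<in> verts G\<close> matters for \<open>n = 0\<close>: the
  zeroth power relates every point to itself, but an empty walk must sit at a vertex.\<close>

lemma awalk_length_iff_relpow:
  "(\<exists>p. awalk u p v \<and> length p = n) \<longleftrightarrow> u \<in> verts G \<and> (u, v) \<in> arcs_ends G ^^ n"
proof (induction n arbitrary: u)
  case 0
  then show ?case by (auto simp: awalk_Nil_iff)
next
  case (Suc n)
  have "(\<exists>p. awalk u p v \<and> length p = Suc n) \<longleftrightarrow>
      (\<exists>e\<in>arcs G. u = tail G e \<and> (\<exists>p. awalk (head G e) p v \<and> length p = n))"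
  proof
    assume "\<exists>p. awalk u p v \<and> length p = Suc n"
    then show "\<exists>e\<in>arcs G. u = tail G e \<and> (\<exists>p. awalk (head G e) p v \<and> length p = n)"
      by (force simp: length_Suc_conv awalk_Cons_iff)
  next
    assume "\<exists>e\<in>arcs G. u = tail G e \<and> (\<exists>p. awalk (head G e) p v \<and> length p = n)"
    then obtain e p where "e \<in> arcs G" "u = tail G e" "awalk (head G e) p v" "length p = n"
      by blast
    then have "awalk u (e # p) v" "length (e # p) = Suc n" by (auto simp: awalk_Cons_iff)
    then show "\<exists>p. awalk u p v \<and> length p = Suc n" by blast
  qed
  also have "\<dots> \<longleftrightarrow> (\<exists>e\<in>arcs G. u = tail G e \<and> (head G e, v) \<in> arcs_ends G ^^ n)"
    unfolding Suc using head_in_verts by blast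
  also have "\<dots> \<longleftrightarrow> (\<exists>z. (u, z) \<in> arcs_ends G \<and> (z, v) \<in> arcs_ends G ^^ n)"
    by (auto simp: arcs_ends_conv)
  also have "\<dots> \<longleftrightarrow> u \<in> verts G \<and> (u, v) \<in> arcs_ends G ^^ Suc n"
    by (meson adj_in_verts(1) relpow_Suc_D2 relpow_Suc_I2)
  finally show ?case .
qed

text \<open>With unit weights the cost of a walk is its length, so the infimum defining the distance
  is attained by a shortest walk.\<close>

lemma graph_dist_eq_Least:
  assumes "u \<rightarrow>\<^sup>* v"
  shows "graph_dist G u v = real (LEAST n. (u, v) \<in> arcs_ends G ^^ n)"
proof -
  have u: "u \<in> verts G" using assms by (rule reachable_in_verts)
  have cost: "awalk_cost (\<lambda>_. 1) p = real (length p)" for p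
    by (induction p) auto
  define l where "l = (LEAST n. (u, v) \<in> arcs_ends G ^^ n)"
  obtain p0 where "awalk u p0 v" using assms reachable_awalk by blast
  then have "(u, v) \<in> arcs_ends G ^^ length p0" using awalk_length_iff_relpow by blast
  then have "(u, v) \<in> arcs_ends G ^^ l" unfolding l_def by (rule LeastI)
  then obtain p where p: "awalk u p v" "length p = l" using awalk_length_iff_relpow u by blast
  have "\<mu> (\<lambda>_. 1) u v = ereal (real l)"
    unfolding \<mu>_def
  proof (rule INF_eqI)
    fix q assume "q \<in> {p. awalk u p v}"
    then have "(u, v) \<in> arcs_ends G ^^ length q" using awalk_length_iff_relpow by blast
    then show "ereal (real l) \<le> ereal (awalk_cost (\<lambda>_. 1) q)"
      unfolding l_def cost by (simp add: Least_le)
  next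
    fix t assume "\<And>q. q \<in> {p. awalk u p v} \<Longrightarrow> t \<le> ereal (awalk_cost (\<lambda>_. 1) q)"
    from this[of p] show "t \<le> ereal (real l)" using p by (simp add: cost)
  qed
  then show ?thesis by (simp add: graph_dist_def l_def)
qed

end

section \<open>From bounds on arcs to the Lipschitz constant\<close>

text \<open>The assumption \<open>nondegenerate\<close> excludes a one-vertex graph with empty
  \<open>\<Omega>\<close>: its vertex has no neighbour, so no map is harmonic there.\<close>

theorem theorem3:
  fixes G :: "('v, 'e) pre_digraph" and Z :: "'z set" and dZ :: "'z \<Rightarrow> 'z \<Rightarrow> real"
    and \<Omega> :: "'v set" and f :: "'v \<Rightarrow> 'z"
  assumes "absolute_1_Lipschitz_retract Z dZ"
    and "graph G" and "Digraph_Component.connected G"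
    and "\<Omega> \<subseteq> verts G" and "f \<in> \<Omega> \<rightarrow> Z"
    and nondegenerate: "\<Omega> \<noteq> {} \<or> card (verts G) \<ge> 2"
  shows "\<exists>h \<in> verts G \<rightarrow> Z.
    infinity_harmonic_on G dZ h (verts G - \<Omega>) \<and>
    (\<forall>v\<in>\<Omega>. h v = f v) \<and>
    lip_const (graph_dist G) dZ (verts G) h = lip_const (graph_dist G) dZ \<Omega> f"
proof -
  interpret G: graph G by fact
  interpret MZ: Metric_space Z dZ
    using assms(1) by (simp add: absolute_1_Lipschitz_retract_def)
  let ?V = "verts G" and ?E = "arcs_ends G"
  have EV: "?E \<subseteq> ?V \<times> ?V" using G.adj_in_verts by auto
  have symE: "sym ?E" using G.sym_arcs by (simp add: symmetric_def)
  have sc: "strongly_connected G"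
    using G.symmetric_connected_imp_strongly_connected G.sym_arcs assms(3) by blast
  have reach: "u \<rightarrow>\<^sup>*\<^bsub>G\<^esub> v" if "u \<in> ?V" "v \<in> ?V" for u v
    using sc that by blast
  have ex: "\<exists>n. (u, v) \<in> ?E ^^ n" if "u \<in> ?V" "v \<in> ?V" for u v
    using reach[OF that] reachable_rtranclI rtrancl_imp_relpow by metis
  define d where "d u v = real (LEAST n. (u, v) \<in> ?E ^^ n)" for u v
  have d: "Metric_space ?V d"
    unfolding d_def
  proof (rule Metric_space_Least)
    show "\<exists>k\<le>m + n. (x, z) \<in> ?E ^^ k" if "(x, y) \<in> ?E ^^ m" "(y, z) \<in> ?E ^^ n" for m n x y z
      using relpow_trans[OF that] by blast
  qed (use ex symE in \<open>auto intro: sym_relpow\<close>)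
  have d_walk: "(u, v) \<in> ?E ^^ n \<Longrightarrow> d u v \<le> real n" for u v n
    unfolding d_def by (simp add: Least_le)
  have dist: "graph_dist G u v = d u v" if "u \<in> ?V" "v \<in> ?V" for u v
    using G.graph_dist_eq_Least[OF reach[OF that]] by (simp add: d_def)
  have lip_dist: "lip_const (graph_dist G) dZ S h = lip_const d dZ S h" if "S \<subseteq> ?V" for S h
    unfolding lip_const_def by (rule SUP_cong) (use dist that in \<open>auto simp: subset_iff\<close>)
  have "lip_const d dZ \<Omega> f < \<infinity>"
  proof -
    have "finite ((\<lambda>(x, y). dZ (f x) (f y) / d x y) ` (\<Omega> \<times> \<Omega>))"
      using assms(4) G.finite_verts finite_subset by blast
    then have "bdd_above ((\<lambda>(x, y). dZ (f x) (f y) / d x y) ` (\<Omega> \<times> \<Omega>))"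
      by (rule bdd_above_finite)
    then obtain B where "\<And>x y. x \<in> \<Omega> \<Longrightarrow> y \<in> \<Omega> \<Longrightarrow> dZ (f x) (f y) / d x y \<le> B"
      by (force simp: bdd_above_def)
    then have "lip_const d dZ \<Omega> f \<le> ennreal B"
      unfolding lip_const_def by (intro SUP_least) (auto intro: ennreal_leI)
    then show ?thesis by (metis ennreal_less_top infinity_ennreal_def le_less_trans)
  qed
  then obtain K where K: "K \<ge> 0" "lip_const d dZ \<Omega> f = ennreal K"
    by (metis ennreal_cases infinity_ennreal_def less_irrefl)
  have lip: "dZ (f x) (f y) \<le> K * d x y" if "x \<in> \<Omega>" "y \<in> \<Omega>" for x y
  proof (cases "x = y")
    case True
    then have "dZ (f x) (f y) = 0" using assms(5) that by (auto simp: MZ.mdist_zero Pi_iff)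
    then show ?thesis using K(1) by (simp add: d_def)
  next
    case False
    then show ?thesis using lip_const_le_iff[OF d assms(4) K(1), of dZ f] K(2) that by simp
  qed
  have walk: "dZ (f x) (f y) \<le> K * real n"
    if "x \<in> \<Omega>" "y \<in> \<Omega>" "(x, y) \<in> ?E ^^ n" for x y n
    using lip[OF that(1,2)] mult_left_mono[OF d_walk[OF that(3)] K(1)] by linarith
  \<comment> \<open>By connectedness a walk leads from \<open>v\<close> to some other vertex, and
    its first arc ends in a neighbour of \<open>v\<close>.\<close>
  have nbr: "neighbours G v \<noteq> {}" if v: "v \<in> ?V - \<Omega>" for v
  proof -
    have "\<exists>u\<in>?V. u \<noteq> v"
    proof (cases "\<Omega> = {}")
      case True
      then have "card ?V \<ge> 2" using nondegenerate by simp
      moreover have "card ?V \<le> 1" if "?V \<subseteq> {v}" using card_mono[OF _ that] by simp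
      ultimately show ?thesis by fastforce
    next
      case False
      then obtain u where "u \<in> \<Omega>" by blast
      then show ?thesis using v assms(4) by auto
    qed
    then obtain u where u: "u \<in> ?V" "u \<noteq> v" by blast
    then obtain n where "(v, u) \<in> ?E ^^ n" using ex v by blast
    with u(2) obtain z where "(v, z) \<in> ?E" 
      by (cases n) (simp, meson relpow_Suc_D2)
    then show ?thesis by (auto simp: neighbours_def)
  qed
  have "edges_off G \<Omega> \<subseteq> ?E" by (auto simp: edges_off_def)
  then have "edges_off G \<Omega> ^^ n \<subseteq> ?E ^^ n" for n by (induction n) auto
  then obtain h where h: "h \<in> ?V \<rightarrow> Z" "infinity_harmonic_on G dZ h (?V - \<Omega>)"
    "\<forall>s\<in>\<Omega>. h s = f s" "\<forall>(x, y)\<in>edges_off G \<Omega>. dZ (h x) (h y) \<le> K"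
    using infinity_harmonic_extension[OF assms(1,2) nbr assms(4,5) K(1)] walk by blast
  \<comment> \<open>The extension says nothing about arcs inside \<open>\<Omega>\<close>; these are
    walks of length 1, bounded by the Lipschitz constant of \<open>f\<close>.\<close>
  have edge: "dZ (h x) (h y) \<le> K" if "(x, y) \<in> ?E" for x y
  proof (cases "(x, y) \<in> edges_off G \<Omega>")
    case True
    then show ?thesis using h(4) by blast
  next
    case False
    then have "x \<in> \<Omega>" "y \<in> \<Omega>" using that by (auto simp: edges_off_def)
    then show ?thesis using walk[of x y 1] h(3) that by simp
  qed
  \<comment> \<open>Summing the arc bound along a shortest walk gives the Lipschitz bound for all
    pairs of vertices.\<close>
  have "dZ (h x) (h y) \<le> K * d x y" if "x \<in> ?V" "y \<in> ?V" for x y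
    unfolding d_def
    using Metric_space_relpow_bound[OF MZ.Metric_space_axioms h(1) EV edge that(1)]
      LeastI_ex[OF ex[OF that]] by blast
  then have "lip_const d dZ ?V h \<le> ennreal K"
    unfolding lip_const_le_iff[OF d order_refl K(1)] by blast
  moreover have "lip_const d dZ \<Omega> f = lip_const d dZ \<Omega> h"
    unfolding lip_const_def by (rule SUP_cong) (auto simp: h(3))
  moreover have "lip_const d dZ \<Omega> h \<le> lip_const d dZ ?V h"
    unfolding lip_const_def using assms(4) by (intro SUP_subset_mono) auto
  ultimately have "lip_const d dZ ?V h = lip_const d dZ \<Omega> f" using K(2) by simp
  with h show ?thesis using lip_dist assms(4) by auto
qed

end
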